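(* Let $b$ be a Baer subline of $\ell_\infty$ in $\mathrm{PG}(2,q^2)$, and let $\bar P,\bar Q\in\ell_\infty$ be distinct points that are conjugate with respect to $b$. Then in $\mathrm{PG}(4,q^2)$ the lines $PQ^q$ and $P^qQ$ are lines of the extended regulus $[b]^\star$.
   Context: Bruck–Bose setting: $q$ a prime power; $\Sigma_\infty$ a hyperplane of $\mathrm{PG}(4,q)$ with a regular spread $\mathcal S$ whose lines $[T]$ correspond to the points $\bar T\in\ell_\infty$ of $\mathrm{PG}(2,q^2)$. In $\mathrm{PG}(4,q^2)$ the transversals of $\mathcal S$ are the two conjugate lines $g,g^q$ (conjugation $X\mapsto X^q$ on coordinates) such that for each $\bar T\in\ell_\infty$, with $T:=[T]^\star\cap g$, the extended spread line is $[T]^\star=TT^q$; this gives a bijection $\bar T\leftrightarrow T$ between $\ell_\infty$ and $g$. A Baer subline $b$ of $\ell_\infty$ corresponds to the regulus $[b]=\{[T]:\bar T\in b\}$ contained in $\mathcal S$; $[b]^\star$ denotes the regulus of $\Sigma_\infty^\star$ consisting of the $q^2+1$ lines of the same ruling of the extended hyperbolic quadric (the quadric covered by $[b]$, extended to $\mathrm{PG}(4,q^2)$) that contains the extensions of the lines of $[b]$. Two points of $\ell_\infty$ are conjugate with respect to $b$ if they are interchanged by the unique involutory (semilinear) collineation of $\ell_\infty$ fixing $b$ pointwise. *)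

theory Defs
  imports "HOL-Analysis.Finite_Cartesian_Product" "HOL-Computational_Algebra.Primes"
begin

section \<open>Coordinates\<close>

text \<open>K = GF(q^2) is a finite field type 'a with CARD('a) = q^2.  Points of PG(n,q^2) are
nonzero vectors of 'a^'n (up to nonzero scalars); the Baer subgeometry PG(n,q) consists of
the points with all coordinates in GF(q).  Conjugation is X |-> X^q on coordinates.\<close>

definition vconj :: "nat \<Rightarrow> 'a::field ^'n \<Rightarrow> 'a ^'n" where
  "vconj q v = (\<chi> i. (v $ i) ^ q)"

text \<open>A vector with all coordinates in GF(q) (i.e. fixed by conjugation).\<close>
definition rational :: "nat \<Rightarrow> 'a::field ^'n \<Rightarrow> bool" where
  "rational q v \<longleftrightarrow> vconj q v = v"

text \<open>Two nonzero vectors represent the same projective point.\<close>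
definition same_point :: "'a::field ^'n \<Rightarrow> 'a ^'n \<Rightarrow> bool" where
  "same_point u v \<longleftrightarrow> u \<noteq> 0 \<and> v \<noteq> 0 \<and> (\<exists>c. c \<noteq> 0 \<and> u = c *s v)"

definition lin_indep2 :: "'a::field ^'n \<Rightarrow> 'a ^'n \<Rightarrow> bool" where
  "lin_indep2 u v \<longleftrightarrow> (\<forall>a b. a *s u + b *s v = 0 \<longrightarrow> a = 0 \<and> b = 0)"

text \<open>The (vector-space) span of two vectors; the line joining two distinct points.\<close>
definition span2 :: "'a::field ^'n \<Rightarrow> 'a ^'n \<Rightarrow> ('a ^'n) set" where
  "span2 u v = {a *s u + b *s v | a b. True}"

text \<open>Lines of PG(n,q^2), as 2-dimensional subspaces.\<close>
definition is_line :: "('a::field ^'n) set \<Rightarrow> bool" where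
  "is_line L \<longleftrightarrow> (\<exists>u v. lin_indep2 u v \<and> L = span2 u v)"

text \<open>(Extensions to PG(n,q^2) of) lines of the subgeometry PG(n,q).\<close>
definition is_rational_line :: "nat \<Rightarrow> ('a::field ^'n) set \<Rightarrow> bool" where
  "is_rational_line q L \<longleftrightarrow>
     (\<exists>u v. rational q u \<and> rational q v \<and> lin_indep2 u v \<and> L = span2 u v)"

definition meets :: "('a::field ^'n) set \<Rightarrow> ('a ^'n) set \<Rightarrow> bool" where
  "meets L M \<longleftrightarrow> (\<exists>z. z \<noteq> 0 \<and> z \<in> L \<and> z \<in> M)"

definition field_aut :: "('a::field \<Rightarrow> 'a) \<Rightarrow> bool" where
  "field_aut \<theta> \<longleftrightarrow> bij \<theta> \<and> (\<forall>x y. \<theta> (x + y) = \<theta> x + \<theta> y) \<and> (\<forall>x y. \<theta> (x * y) = \<theta> x * \<theta> y)"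

text \<open>Semilinear map x |-> A x^\<theta>.\<close>
definition semilin :: "'a::field ^'n^'m \<Rightarrow> ('a \<Rightarrow> 'a) \<Rightarrow> 'a ^'n \<Rightarrow> 'a ^'m" where
  "semilin A \<theta> x = A *v (\<chi> i. \<theta> (x $ i))"

definition nonsingular :: "'a::field ^'n^'m \<Rightarrow> bool" where
  "nonsingular A \<longleftrightarrow> (\<forall>x. A *v x = 0 \<longrightarrow> x = 0)"

section \<open>The line at infinity l_inf = PG(1,q^2): Baer sublines and conjugacy\<close>

text \<open>A Baer subline of PG(1,q^2): the image of PG(1,q) under a projectivity
(as a set of vectors, closed under nonzero scalars).\<close>
definition baer_subline :: "nat \<Rightarrow> ('a::field ^2) set \<Rightarrow> bool" where
  "baer_subline q b \<longleftrightarrow> (\<exists>M :: 'a^2^2. nonsingular M \<and>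
      b = {c *s (M *v r) | c r. c \<noteq> 0 \<and> r \<noteq> 0 \<and> rational q r})"

text \<open>P and Q are conjugate w.r.t. b: they are interchanged by an involutory collineation
of PG(1,q^2) (induced by a nonsingular semilinear map) fixing b pointwise.  (This collineation
is unique.)\<close>
definition conjugate_wrt :: "('a::field ^2) set \<Rightarrow> 'a ^2 \<Rightarrow> 'a ^2 \<Rightarrow> bool" where
  "conjugate_wrt b P Q \<longleftrightarrow> (\<exists>(A :: 'a^2^2) \<theta>. nonsingular A \<and> field_aut \<theta> \<and>
      (\<forall>x. x \<noteq> 0 \<longrightarrow> same_point (semilin A \<theta> (semilin A \<theta> x)) x) \<and>
      (\<forall>x\<in>b. same_point (semilin A \<theta> x) x) \<and>
      same_point (semilin A \<theta> P) Q \<and> same_point (semilin A \<theta> Q) P)"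

section \<open>Bruck--Bose: reguli in Sigma_inf\<close>

text \<open>With \<phi> the bijection Tbar |-> T from l_inf onto the transversal g, the extended spread
line is [T]* = T T^q.\<close>
definition spread_line :: "nat \<Rightarrow> ('a::field ^2 \<Rightarrow> 'a ^5) \<Rightarrow> 'a ^2 \<Rightarrow> ('a ^5) set" where
  "spread_line q \<phi> x = span2 (\<phi> x) (vconj q (\<phi> x))"

text \<open>Lines of PG(4,q) meeting every line of the regulus [b] (the opposite regulus).\<close>
definition opposite_regulus :: "nat \<Rightarrow> ('a::field ^2 \<Rightarrow> 'a ^5) \<Rightarrow> ('a ^2) set \<Rightarrow> ('a ^5) set set" where
  "opposite_regulus q \<phi> b =
     {m. is_rational_line q m \<and> (\<forall>x\<in>b. meets m (spread_line q \<phi> x))}"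

text \<open>[b]*: the lines of PG(4,q^2) meeting (the extensions of) all lines of the opposite
regulus, i.e. the ruling of the extended hyperbolic quadric containing the extensions of the
lines of [b].\<close>
definition ext_regulus :: "nat \<Rightarrow> ('a::field ^2 \<Rightarrow> 'a ^5) \<Rightarrow> ('a ^2) set \<Rightarrow> ('a ^5) set set" where
  "ext_regulus q \<phi> b = {L. is_line L \<and> (\<forall>m\<in>opposite_regulus q \<phi> b. meets L m)}"

end

(* Sigma_inf^* is spanned by the transversal g = range B and its conjugate g^q, which are
   skew, so its points are uniquely D(s,t) = B s + (B t)^q; conjugation swaps s and t, and the
   rational points are the D(u,u). A line m of the opposite regulus is spanned by two of them,
   so it consists of the points D(a u1 + c u2, a^q u1 + c^q u2). That m meets the spread lines
   over a frame y1, y2, y1 + y2 of the Baer subline forces a u1 + c u2 |-> a^q u1 + c^q u2 to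
   be, up to a scalar, the coordinatewise Frobenius map in the basis y1, y2; hence m meets the
   line through B(x1 y1 + x2 y2) and B(x1^q y1 + x2^q y2)^q for all x1, x2. On the other hand
   the involution fixing the Baer subline pointwise is, in coordinates with respect to a frame,
   x |-> x^q, so P and Q have conjugate coordinates and P Q^q is one of these lines. *)

theory Submission
  imports Defs "HOL-Analysis.Cartesian_Space"
begin

section \<open>Finite fields of square order\<close>

lemma of_nat_card_eq_0: "of_nat CARD('a::{finite,ring_1}) = (0::'a)"
proof -
  have "(\<Sum>y\<in>UNIV. 1 + y) = (\<Sum>y::'a\<in>UNIV. y)"
    by (rule sum.reindex_bij_witness[of _ "\<lambda>y. y - 1" "\<lambda>y. 1 + y"]) auto
  then show ?thesis by (simp add: sum.distrib)
qed

lemma power_card_eq_self: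
  fixes x :: "'a::{finite,field}"
  shows "x ^ CARD('a) = x"
proof (cases "x = 0")
  case False
  have "(\<Prod>y\<in>UNIV-{0}. x * y) = (\<Prod>y\<in>UNIV-{0}. y)"
    by (rule prod.reindex_bij_witness[of _ "\<lambda>y. y / x" "\<lambda>y. x * y"]) (use False in auto)
  then have "x ^ (CARD('a) - 1) = 1"
    by (simp add: prod.distrib card_Diff_singleton)
  moreover have "CARD('a) = Suc (CARD('a) - 1)"
    using finite_UNIV_card_ge_0[where 'a='a] by simp
  ultimately show ?thesis
    by (metis power_Suc mult_1_right)
qed (use finite_UNIV_card_ge_0[where 'a='a] in simp)

locale frobenius_involution =
  fixes field :: "'a::field itself" and q :: nat
  assumes frobenius_add: "(x + y :: 'a) ^ q = x ^ q + y ^ q"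
    and frobenius_frobenius [simp]: "((x :: 'a) ^ q) ^ q = x"

lemma frobenius_involution_if_card_square:
  fixes q :: nat
  assumes "\<exists>p k. prime p \<and> k > 0 \<and> q = p ^ k" and card: "CARD('a::{finite,field}) = q ^ 2"
  shows "frobenius_involution TYPE('a) q"
proof
  obtain p k where p: "prime p" and q: "q = p ^ k" using assms(1) by blast
  have "CHAR('a) dvd p ^ (k * 2)"
    using of_nat_card_eq_0[where 'a='a] of_nat_eq_0_iff_char_dvd
    by (metis card q power_mult)
  moreover have char_prime: "prime CHAR('a)"
    by (simp add: finite_imp_CHAR_pos prime_CHAR_semidom)
  ultimately have "CHAR('a) = p"
    using p prime_dvd_power primes_dvd_imp_eq by blast
  then show "(x + y :: 'a) ^ q = x ^ q + y ^ q" for x y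
    using char_prime q by (simp add: freshmans_dream')
  show "((x :: 'a) ^ q) ^ q = x" for x
    using power_card_eq_self[of x] by (simp add: card power2_eq_square flip: power_mult)
qed

context frobenius_involution
begin

lemma q_pos: "q > 0"
  using frobenius_frobenius[of 0] by (cases q) auto

lemma frobenius_eq_0_iff [simp]: "(x :: 'a) ^ q = 0 \<longleftrightarrow> x = 0"
  using q_pos by simp

lemma frobenius_minus: "(- x :: 'a) ^ q = - (x ^ q)"
proof -
  have "x ^ q + (- x) ^ q = 0"
    using frobenius_add[of x "- x"] q_pos by (simp add: power_0_left)
  then show ?thesis
    by (simp add: eq_neg_iff_add_eq_0 add.commute)
qed

lemma frobenius_diff: "(x - y :: 'a) ^ q = x ^ q - y ^ q"
  using frobenius_add[of x "- y"] by (simp add: frobenius_minus)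

lemma vconj_add: "vconj q (u + v :: 'a^'n) = vconj q u + vconj q v"
  by (simp add: vconj_def vec_eq_iff frobenius_add)

lemma vconj_minus: "vconj q (- u :: 'a^'n) = - vconj q u"
  by (simp add: vconj_def vec_eq_iff frobenius_minus)

lemma vconj_diff: "vconj q (u - v :: 'a^'n) = vconj q u - vconj q v"
  by (simp add: vconj_def vec_eq_iff frobenius_diff)

lemma vconj_smult: "vconj q (c *s u :: 'a^'n) = c ^ q *s vconj q u"
  by (simp add: vconj_def vec_eq_iff power_mult_distrib)

lemma vconj_vconj [simp]: "vconj q (vconj q (u :: 'a^'n)) = u"
  by (simp add: vconj_def vec_eq_iff)

lemma vconj_eq_0_iff [simp]: "vconj q (u :: 'a^'n) = 0 \<longleftrightarrow> u = 0"
  using q_pos by (simp add: vconj_def vec_eq_iff)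

end

section \<open>Pairs of vectors\<close>

lemma in_span2_iff: "z \<in> span2 u v \<longleftrightarrow> (\<exists>a b. z = a *s u + b *s v)"
  unfolding span2_def by blast

lemma span2_base: "u \<in> span2 u v" "v \<in> span2 u (v :: 'a::field^'n)"
  unfolding in_span2_iff
  by (rule exI[of _ 1], rule exI[of _ 0], simp) (rule exI[of _ 0], rule exI[of _ 1], simp)

lemma span2_commute: "span2 u v = span2 v u"
  unfolding span2_def by (auto; metis add.commute)

lemma span2_smult_right:
  fixes u v :: "'a::field^'n"
  assumes "c \<noteq> 0"
  shows "span2 u (c *s v) = span2 u v"
proof -
  have "a *s u + b *s (c *s v) = a *s u + (b * c) *s v" for a b
    by (simp add: vector_smult_assoc)
  moreover have "a *s u + b *s v = a *s u + (b / c) *s (c *s v)" for a b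
    using assms by (simp add: vector_smult_assoc)
  ultimately show ?thesis
    unfolding set_eq_iff in_span2_iff by metis
qed

lemma same_point_commute: "same_point u v \<longleftrightarrow> same_point v (u :: 'a::field^'n)"
proof -
  have "same_point v u" if uv: "same_point u v" for u v :: "'a^'n"
  proof -
    obtain c where "u \<noteq> 0" "v \<noteq> 0" "c \<noteq> 0" "u = c *s v"
      using uv unfolding same_point_def by blast
    then have "v = (1 / c) *s u"
      by (simp add: vector_smult_assoc)
    then show ?thesis
      unfolding same_point_def using \<open>u \<noteq> 0\<close> \<open>v \<noteq> 0\<close> \<open>c \<noteq> 0\<close> by auto
  qed
  then show ?thesis
    by blast
qed

lemma meets_commute: "meets L M \<longleftrightarrow> meets M L"
  unfolding meets_def by blast

lemma lin_indep2_change_of_basis: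
  fixes w1 w2 z1 z2 :: "'a::field^'n"
  assumes indep: "lin_indep2 z1 z2"
    and z1: "z1 = a1 *s w1 + b1 *s w2" and z2: "z2 = a2 *s w1 + b2 *s w2"
  defines "d \<equiv> a1 * b2 - a2 * b1"
  shows "d \<noteq> 0" and "d *s w1 = b2 *s z1 + (- b1) *s z2" and "d *s w2 = (- a2) *s z1 + a1 *s z2"
proof -
  show w1: "d *s w1 = b2 *s z1 + (- b1) *s z2" and w2: "d *s w2 = (- a2) *s z1 + a1 *s z2"
    unfolding z1 z2 d_def by (simp_all add: vec_eq_iff algebra_simps)
  show "d \<noteq> 0"
  proof
    assume "d = 0"
    then have "b2 *s z1 + (- b1) *s z2 = 0" and "(- a2) *s z1 + a1 *s z2 = 0"
      using w1 w2 by simp_all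
    then have "b2 = 0 \<and> - b1 = 0" and "- a2 = 0 \<and> a1 = 0"
      using indep unfolding lin_indep2_def by blast+
    then have "1 *s z1 + 0 *s z2 = 0"
      by (simp add: z1)
    then have "(1::'a) = 0"
      using indep unfolding lin_indep2_def by blast
    then show False
      by simp
  qed
qed

lemma span2_subset_if_lin_indep2:
  fixes w1 w2 z1 z2 :: "'a::field^'n"
  assumes "lin_indep2 z1 z2" "z1 \<in> span2 w1 w2" "z2 \<in> span2 w1 w2"
  shows "span2 w1 w2 \<subseteq> span2 z1 z2"
proof
  obtain a1 b1 a2 b2 where z: "z1 = a1 *s w1 + b1 *s w2" "z2 = a2 *s w1 + b2 *s w2"
    using assms(2,3) unfolding in_span2_iff by blast
  define d where "d = a1 * b2 - a2 * b1"
  note basis = lin_indep2_change_of_basis[OF assms(1) z, folded d_def]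
  fix x assume "x \<in> span2 w1 w2"
  then obtain e f where "x = e *s w1 + f *s w2"
    unfolding in_span2_iff by blast
  also have "\<dots> = (1 / d) *s (e *s (d *s w1) + f *s (d *s w2))"
    using basis(1) by (simp add: vector_smult_assoc vector_add_ldistrib)
  also have "\<dots> = (1 / d * (e * b2 - f * a2)) *s z1 + (1 / d * (f * a1 - e * b1)) *s z2"
    unfolding basis(2,3) by (simp add: vec_eq_iff algebra_simps)
  finally show "x \<in> span2 z1 z2"
    unfolding in_span2_iff by blast
qed

lemma lin_indep2_if_span2:
  fixes w1 w2 z1 z2 :: "'a::field^'n"
  assumes "lin_indep2 z1 z2" "z1 \<in> span2 w1 w2" "z2 \<in> span2 w1 w2"
  shows "lin_indep2 w1 w2"
  unfolding lin_indep2_def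
proof (intro allI impI)
  obtain a1 b1 a2 b2 where z: "z1 = a1 *s w1 + b1 *s w2" "z2 = a2 *s w1 + b2 *s w2"
    using assms(2,3) unfolding in_span2_iff by blast
  define d where "d = a1 * b2 - a2 * b1"
  note basis = lin_indep2_change_of_basis[OF assms(1) z, folded d_def]
  fix e f assume "e *s w1 + f *s w2 = 0"
  then have "e *s (d *s w1) + f *s (d *s w2) = 0"
    by (metis vector_smult_assoc mult.commute vector_add_ldistrib vector_smult_rzero)
  then have "(e * b2 - f * a2) *s z1 + (f * a1 - e * b1) *s z2 = 0"
    unfolding basis(2,3) by (simp add: vec_eq_iff algebra_simps)
  then have "e * b2 - f * a2 = 0 \<and> f * a1 - e * b1 = 0"
    using assms(1) unfolding lin_indep2_def by blast
  then have "e * b2 = f * a2" "f * a1 = e * b1"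
    by simp_all
  moreover have "e * d = a1 * (e * b2) - a2 * (e * b1)" "f * d = b2 * (f * a1) - b1 * (f * a2)"
    unfolding d_def by (simp_all add: algebra_simps)
  ultimately have "e * d = a1 * (f * a2) - a2 * (f * a1)" "f * d = b2 * (e * b1) - b1 * (e * b2)"
    by simp_all
  then have "e * d = 0" "f * d = 0"
    by (simp_all add: algebra_simps)
  then show "e = 0 \<and> f = 0"
    using basis(1) by simp
qed

lemma lin_indep2_spans_plane:
  fixes u v x :: "'a::field^2"
  assumes "lin_indep2 u v"
  shows "x \<in> span2 u v"
proof -
  have basis: "y \<in> span2 (axis 1 1) (axis 2 1)" for y :: "'a^2"
    unfolding in_span2_iff
    by (intro exI[of _ "y $ 1"] exI[of _ "y $ 2"]) (simp add: vec_eq_iff forall_2 axis_def)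
  show ?thesis
    using span2_subset_if_lin_indep2[OF assms basis basis] basis by blast
qed

lemma smult_cancel_lincomb:
  fixes u v y :: "'a::field^'n"
  assumes "\<alpha> \<noteq> 0" "a *s u + c *s v = \<alpha> *s y"
  shows "y = (a / \<alpha>) *s u + (c / \<alpha>) *s v"
proof -
  have "y = (1 / \<alpha>) *s (\<alpha> *s y)"
    using assms(1) by (simp add: vector_smult_assoc)
  also have "\<dots> = (a / \<alpha>) *s u + (c / \<alpha>) *s v"
    unfolding assms(2)[symmetric] by (simp add: vector_add_ldistrib vector_smult_assoc)
  finally show ?thesis .
qed

section \<open>Field automorphisms and semilinear maps\<close>

lemma field_aut_add: "field_aut \<theta> \<Longrightarrow> \<theta> (x + y) = \<theta> x + \<theta> y"
  unfolding field_aut_def by blast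

lemma field_aut_mult: "field_aut \<theta> \<Longrightarrow> \<theta> (x * y) = \<theta> x * \<theta> y"
  unfolding field_aut_def by blast

lemma field_aut_0: "field_aut \<theta> \<Longrightarrow> \<theta> 0 = 0"
  using field_aut_add[of \<theta> 0 0] by (metis add.right_neutral add_left_cancel)

lemma field_aut_eq_iff: "field_aut \<theta> \<Longrightarrow> \<theta> x = \<theta> y \<longleftrightarrow> x = y"
  unfolding field_aut_def bij_def by (auto dest: injD)

lemma field_aut_eq_0_iff: "field_aut \<theta> \<Longrightarrow> \<theta> x = 0 \<longleftrightarrow> x = 0"
  by (metis field_aut_0 field_aut_eq_iff)

lemma field_aut_1: "field_aut \<theta> \<Longrightarrow> \<theta> 1 = 1"
  using field_aut_mult[of \<theta> 1 1] field_aut_eq_0_iff[of \<theta> 1] by simp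

lemma field_aut_power: "field_aut \<theta> \<Longrightarrow> \<theta> (x ^ n) = \<theta> x ^ n"
  by (induction n) (simp_all add: field_aut_1 field_aut_mult)

lemma field_aut_surj: "field_aut \<theta> \<Longrightarrow> \<exists>x. \<theta> x = y"
  unfolding field_aut_def bij_def by (metis surjD)

definition vmap :: "('a \<Rightarrow> 'b) \<Rightarrow> 'a^'n \<Rightarrow> 'b^'n" where
  "vmap f v = (\<chi> i. f (v $ i))"

lemma semilin_eq_vmap: "semilin A \<theta> x = A *v vmap \<theta> x"
  unfolding semilin_def vmap_def ..

lemma vmap_lincomb:
  "field_aut \<theta> \<Longrightarrow> vmap \<theta> (a *s u + c *s v) = \<theta> a *s vmap \<theta> u + \<theta> c *s vmap \<theta> v"
  by (simp add: vmap_def vec_eq_iff field_aut_add field_aut_mult)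

lemma vmap_eq_0_iff: "field_aut \<theta> \<Longrightarrow> vmap \<theta> v = 0 \<longleftrightarrow> v = 0"
  by (simp add: vmap_def vec_eq_iff field_aut_eq_0_iff)

lemma semilin_lincomb:
  "field_aut \<theta> \<Longrightarrow>
    semilin A \<theta> (a *s u + c *s v) = \<theta> a *s semilin A \<theta> u + \<theta> c *s semilin A \<theta> v"
  by (simp add: semilin_eq_vmap vmap_lincomb vec.add vec.scale)

lemma lin_indep2_vmap:
  assumes \<theta>: "field_aut \<theta>" and "lin_indep2 u v"
  shows "lin_indep2 (vmap \<theta> u) (vmap \<theta> v)"
  unfolding lin_indep2_def
proof (intro allI impI)
  fix a c assume "a *s vmap \<theta> u + c *s vmap \<theta> v = 0"
  moreover obtain a' c' where "\<theta> a' = a" "\<theta> c' = c"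
    using field_aut_surj[OF \<theta>] by metis
  ultimately have "vmap \<theta> (a' *s u + c' *s v) = 0"
    by (simp add: vmap_lincomb[OF \<theta>])
  then have "a' = 0 \<and> c' = 0"
    using assms(2) unfolding lin_indep2_def vmap_eq_0_iff[OF \<theta>] by blast
  then show "a = 0 \<and> c = 0"
    using \<open>\<theta> a' = a\<close> \<open>\<theta> c' = c\<close> field_aut_0[OF \<theta>] by blast
qed

section \<open>Baer sublines and conjugacy\<close>

definition baer_frame :: "nat \<Rightarrow> ('a::field^'n) set \<Rightarrow> 'a^'n \<Rightarrow> 'a^'n \<Rightarrow> bool" where
  "baer_frame q b m1 m2 \<longleftrightarrow> lin_indep2 m1 m2 \<and>
    (\<forall>r1 r2. r1 ^ q = r1 \<longrightarrow> r2 ^ q = r2 \<longrightarrow> r1 \<noteq> 0 \<or> r2 \<noteq> 0 \<longrightarrow> r1 *s m1 + r2 *s m2 \<in> b)"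

lemma baer_subline_has_frame:
  fixes b :: "('a::field^2) set"
  assumes "baer_subline q b"
  shows "\<exists>m1 m2. baer_frame q b m1 m2"
proof -
  obtain M :: "'a^2^2" where M: "nonsingular M"
    and b: "b = {c *s (M *v r) | c r. c \<noteq> 0 \<and> r \<noteq> 0 \<and> rational q r}"
    using assms unfolding baer_subline_def by blast
  have M_vector: "M *v vector [r1, r2] = r1 *s column 1 M + r2 *s column 2 M" for r1 r2
    by (simp add: matrix_mult_sum sum_2)
  have "lin_indep2 (column 1 M) (column 2 M)"
    unfolding lin_indep2_def
  proof (intro allI impI)
    fix r1 r2 assume "r1 *s column 1 M + r2 *s column 2 M = 0"
    then have "vector [r1, r2] = (0 :: 'a^2)"
      using M unfolding nonsingular_def M_vector[symmetric] by blast
    then show "r1 = 0 \<and> r2 = 0"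
      by (metis vector_2 zero_index)
  qed
  moreover have "r1 *s column 1 M + r2 *s column 2 M \<in> b"
    if "r1 ^ q = r1" "r2 ^ q = r2" "r1 \<noteq> 0 \<or> r2 \<noteq> 0" for r1 r2
  proof -
    have "rational q (vector [r1, r2] :: 'a^2)"
      using that by (simp add: rational_def vconj_def vec_eq_iff forall_2)
    moreover have "vector [r1, r2] \<noteq> (0 :: 'a^2)"
      using that by (metis vector_2 zero_index)
    moreover have "r1 *s column 1 M + r2 *s column 2 M = 1 *s (M *v vector [r1, r2])"
      by (simp add: M_vector)
    ultimately show ?thesis
      unfolding b mem_Collect_eq by (intro exI[of _ "1::'a"] exI[of _ "vector [r1, r2]"]) simp
  qed
  ultimately show ?thesis
    unfolding baer_frame_def by blast
qed

lemma conjugate_wrt_commute: "conjugate_wrt b P Q \<longleftrightarrow> conjugate_wrt b Q P"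
  unfolding conjugate_wrt_def by blast

context frobenius_involution
begin

lemma field_aut_fixing_subfield:
  fixes z :: 'a
  assumes \<theta>: "field_aut \<theta>" and fixed: "\<And>t. t ^ q = t \<Longrightarrow> \<theta> t = t"
  shows "\<theta> z = z \<or> \<theta> z = z ^ q"
proof -
  \<comment> \<open>z is a root of X^2 - s X + n, whose coefficients lie in GF(q)\<close>
  define s n where "s = z + z ^ q" and "n = z * z ^ q"
  have "s ^ q = s" "n ^ q = n"
    by (simp_all add: s_def n_def frobenius_add power_mult_distrib add.commute mult.commute)
  have "z * z + n = s * z"
    by (simp add: s_def n_def algebra_simps)
  then have "\<theta> z * \<theta> z + n = s * \<theta> z"
    using fixed[OF \<open>s ^ q = s\<close>] fixed[OF \<open>n ^ q = n\<close>] by (metis \<theta> field_aut_add field_aut_mult)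
  then have "(\<theta> z - z) * (\<theta> z - z ^ q) = 0"
    by (simp add: s_def n_def algebra_simps)
  then show ?thesis
    by simp
qed

lemma field_aut_fixing_subfield_pair:
  fixes x1 x2 :: 'a
  assumes \<theta>: "field_aut \<theta>" and fixed: "\<And>t. t ^ q = t \<Longrightarrow> \<theta> t = t" and x: "x1 \<noteq> 0 \<or> x2 \<noteq> 0"
  obtains k where "k \<noteq> 0" "\<theta> x1 = k * x1" "\<theta> x2 = k * x2"
    | k where "k \<noteq> 0" "\<theta> x1 = k * x1 ^ q" "\<theta> x2 = k * x2 ^ q"
proof (cases "x1 = 0")
  case True
  then show ?thesis
    using that(1)[of "\<theta> x2 / x2"] x by (simp add: field_aut_0[OF \<theta>] field_aut_eq_0_iff[OF \<theta>])
next
  case False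
  define z where "z = x2 / x1"
  have x2: "x2 = x1 * z"
    using False by (simp add: z_def)
  have "\<theta> x2 = \<theta> x1 * \<theta> z" "\<theta> x1 \<noteq> 0"
    using False by (simp_all add: x2 field_aut_mult[OF \<theta>] field_aut_eq_0_iff[OF \<theta>])
  then show ?thesis
    using field_aut_fixing_subfield[OF \<theta> fixed, of z] that(1)[of "\<theta> x1 / x1"]
      that(2)[of "\<theta> x1 / x1 ^ q"] False x2
    by (auto simp: power_mult_distrib)
qed

lemma baer_frame_points:
  fixes m1 m2 :: "'a^'n"
  assumes "baer_frame q b m1 m2"
  shows "m1 \<in> b" and "m2 \<in> b" and "m1 + m2 \<in> b"
proof -
  have "r1 *s m1 + r2 *s m2 \<in> b" if "r1 ^ q = r1" "r2 ^ q = r2" "r1 \<noteq> 0 \<or> r2 \<noteq> 0" for r1 r2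
    using assms that unfolding baer_frame_def by blast
  from this[of 1 0] this[of 0 1] this[of 1 1] q_pos show "m1 \<in> b" "m2 \<in> b" "m1 + m2 \<in> b"
    by (simp_all add: power_0_left)
qed

lemma collineation_fixing_baer_frame:
  fixes m1 m2 :: "'a^'n"
  assumes \<theta>: "field_aut \<theta>" and frame: "baer_frame q b m1 m2"
    and fixes_b: "\<forall>x\<in>b. same_point (semilin A \<theta> x) x"
  obtains l where "l \<noteq> 0" and "\<And>t. t ^ q = t \<Longrightarrow> \<theta> t = t"
    and "\<And>x1 x2. semilin A \<theta> (x1 *s m1 + x2 *s m2) = l *s (\<theta> x1 *s m1 + \<theta> x2 *s m2)"
proof -
  let ?\<tau> = "semilin A \<theta>"
  have fixed: "\<exists>c. c \<noteq> 0 \<and> ?\<tau> (r1 *s m1 + r2 *s m2) = c *s (r1 *s m1 + r2 *s m2)"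
    if "r1 ^ q = r1" "r2 ^ q = r2" "r1 \<noteq> 0 \<or> r2 \<noteq> 0" for r1 r2
    using fixes_b frame that unfolding baer_frame_def same_point_def by blast
  obtain l where l: "l \<noteq> 0" "?\<tau> m1 = l *s m1"
    using fixed[of 1 0] q_pos by (auto simp: power_0_left)
  obtain l2 where l2: "?\<tau> m2 = l2 *s m2"
    using fixed[of 0 1] q_pos by (auto simp: power_0_left)
  have image: "?\<tau> (x1 *s m1 + x2 *s m2) = (\<theta> x1 * l) *s m1 + (\<theta> x2 * l2) *s m2" for x1 x2
    by (simp add: semilin_lincomb[OF \<theta>] l l2 vector_smult_assoc)
  have eigen: "\<theta> t * l2 = t * l" if t: "t ^ q = t" for t
  proof -
    obtain c where "?\<tau> (1 *s m1 + t *s m2) = c *s (1 *s m1 + t *s m2)"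
      using fixed[of 1 t] t by auto
    then have "(l - c) *s m1 + (\<theta> t * l2 - c * t) *s m2 = 0"
      unfolding image by (simp add: field_aut_1[OF \<theta>] vec_eq_iff algebra_simps)
    then have "l - c = 0 \<and> \<theta> t * l2 - c * t = 0"
      using frame unfolding baer_frame_def lin_indep2_def by blast
    then show ?thesis
      by simp
  qed
  have "l2 = l"
    using eigen[of 1] by (simp add: field_aut_1[OF \<theta>])
  then have "\<theta> t = t" if "t ^ q = t" for t
    using eigen[OF that] l(1) by simp
  moreover have "?\<tau> (x1 *s m1 + x2 *s m2) = l *s (\<theta> x1 *s m1 + \<theta> x2 *s m2)" for x1 x2
    unfolding image \<open>l2 = l\<close> by (simp add: vector_add_ldistrib vector_smult_assoc mult.commute)
  ultimately show ?thesis
    using that l(1) by blast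
qed

lemma conjugate_wrt_frame_coordinates:
  fixes m1 m2 P Q :: "'a^2"
  assumes frame: "baer_frame q b m1 m2"
    and conj: "conjugate_wrt b P Q" and distinct: "\<not> same_point P Q"
  obtains x1 x2 \<kappa> where "x1 \<noteq> 0 \<or> x2 \<noteq> 0" and "\<kappa> \<noteq> 0"
    and "P = x1 *s m1 + x2 *s m2" and "Q = \<kappa> *s (x1 ^ q *s m1 + x2 ^ q *s m2)"
proof -
  obtain A \<theta> where \<theta>: "field_aut \<theta>" and fixes_b: "\<forall>x\<in>b. same_point (semilin A \<theta> x) x"
    and PQ: "same_point (semilin A \<theta> P) Q"
    using conj unfolding conjugate_wrt_def by blast
  obtain l where l: "l \<noteq> 0" and fixed: "\<And>t. t ^ q = t \<Longrightarrow> \<theta> t = t"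
    and image: "\<And>x1 x2. semilin A \<theta> (x1 *s m1 + x2 *s m2) = l *s (\<theta> x1 *s m1 + \<theta> x2 *s m2)"
    using collineation_fixing_baer_frame[OF \<theta> frame fixes_b] by blast
  have indep: "lin_indep2 m1 m2"
    using frame unfolding baer_frame_def by blast
  obtain x1 x2 where P: "P = x1 *s m1 + x2 *s m2"
    using lin_indep2_spans_plane[OF indep] unfolding in_span2_iff by blast
  obtain c where c: "c \<noteq> 0" "semilin A \<theta> P = c *s Q" and "Q \<noteq> 0" "semilin A \<theta> P \<noteq> 0"
    using PQ unfolding same_point_def by blast
  then have x: "x1 \<noteq> 0 \<or> x2 \<noteq> 0"
    using image[of 0 0] by (auto simp: P field_aut_0[OF \<theta>])
  have "Q = (1 / c) *s (c *s Q)"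
    using c(1) by (simp add: vector_smult_assoc)
  also have "\<dots> = (l / c) *s (\<theta> x1 *s m1 + \<theta> x2 *s m2)"
    unfolding c(2)[symmetric] P image by (simp add: vector_smult_assoc)
  finally have Q: "Q = (l / c) *s (\<theta> x1 *s m1 + \<theta> x2 *s m2)" .
  show ?thesis
  proof (rule field_aut_fixing_subfield_pair[OF \<theta> fixed x])
    fix k assume "k \<noteq> 0" "\<theta> x1 = k * x1" "\<theta> x2 = k * x2"
    then have "Q = (l / c * k) *s P" and "P \<noteq> 0"
      using Q x indep unfolding P lin_indep2_def
      by (simp_all add: vector_add_ldistrib vector_smult_assoc mult.assoc) blast
    then have "same_point P Q"
      unfolding same_point_def using \<open>Q \<noteq> 0\<close> \<open>k \<noteq> 0\<close> c l
      by (intro conjI exI[of _ "c / (l * k)"]) (simp_all add: vector_smult_assoc)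
    then show thesis
      using distinct by blast
  next
    fix k assume "k \<noteq> 0" "\<theta> x1 = k * x1 ^ q" "\<theta> x2 = k * x2 ^ q"
    then have "Q = (l / c * k) *s (x1 ^ q *s m1 + x2 ^ q *s m2)"
      using Q by (simp add: vector_add_ldistrib vector_smult_assoc mult.assoc)
    moreover have "l / c * k \<noteq> 0"
      using \<open>k \<noteq> 0\<close> c l by simp
    ultimately show thesis
      using that[OF x _ P] by blast
  qed
qed

end

section \<open>Coordinates on the extended hyperplane at infinity\<close>

(* With D as in transversal_sum below: the line {D(a u1 + c u2, a^q u1 + c^q u2)} meets the
   line through B s and (B t)^q, see meets_transversal_span2_iff. *)
definition twisted_meets :: "nat \<Rightarrow> 'a::field^'n \<Rightarrow> 'a^'n \<Rightarrow> 'a^'n \<Rightarrow> 'a^'n \<Rightarrow> bool" where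
  "twisted_meets q u1 u2 s t \<longleftrightarrow> (\<exists>a c \<alpha> \<beta>. (a \<noteq> 0 \<or> c \<noteq> 0) \<and>
      a *s u1 + c *s u2 = \<alpha> *s s \<and> a ^ q *s u1 + c ^ q *s u2 = \<beta> *s t)"

context frobenius_involution
begin

lemma twisted_meets_in_span2:
  fixes u1 u2 y :: "'a^'n"
  assumes inj: "\<And>a c. a *s u1 + c *s u2 = 0 \<Longrightarrow> a ^ q *s u1 + c ^ q *s u2 = 0 \<Longrightarrow> a = 0 \<and> c = 0"
    and "twisted_meets q u1 u2 y y"
  shows "y \<in> span2 u1 u2"
proof -
  obtain a c \<alpha> \<beta> where ac: "a \<noteq> 0 \<or> c \<noteq> 0"
    and y: "a *s u1 + c *s u2 = \<alpha> *s y" "a ^ q *s u1 + c ^ q *s u2 = \<beta> *s y"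
    using assms(2) unfolding twisted_meets_def by blast
  have "\<alpha> \<noteq> 0 \<or> \<beta> \<noteq> 0"
    using inj[of a c] ac y by auto
  then show ?thesis
    using smult_cancel_lincomb[OF _ y(1)] smult_cancel_lincomb[OF _ y(2)]
    unfolding in_span2_iff by blast
qed

lemma twisted_meets_normalize:
  fixes u1 u2 s t :: "'a^'n"
  assumes "lin_indep2 u1 u2" and "twisted_meets q u1 u2 s t"
  obtains a c l where "a *s u1 + c *s u2 = s" and "a ^ q *s u1 + c ^ q *s u2 = l *s t"
proof -
  obtain a c \<alpha> \<beta> where ac: "a \<noteq> 0 \<or> c \<noteq> 0"
    and st: "a *s u1 + c *s u2 = \<alpha> *s s" "a ^ q *s u1 + c ^ q *s u2 = \<beta> *s t"
    using assms(2) unfolding twisted_meets_def by blast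
  have "\<alpha> \<noteq> 0"
    using assms(1) ac st(1) unfolding lin_indep2_def by auto
  have "(a / \<alpha>) ^ q *s u1 + (c / \<alpha>) ^ q *s u2 = (1 / \<alpha> ^ q) *s (a ^ q *s u1 + c ^ q *s u2)"
    by (simp add: power_divide vector_add_ldistrib vector_smult_assoc)
  also have "\<dots> = (\<beta> / \<alpha> ^ q) *s t"
    by (simp add: st(2) vector_smult_assoc)
  finally show ?thesis
    using that smult_cancel_lincomb[OF \<open>\<alpha> \<noteq> 0\<close> st(1)] by metis
qed

lemma twisted_meets_common_scalar:
  fixes u1 u2 y1 y2 :: "'a^'n"
  assumes u: "lin_indep2 u1 u2" and y: "lin_indep2 y1 y2"
    and meets_y1: "twisted_meets q u1 u2 y1 y1" and meets_y2: "twisted_meets q u1 u2 y2 y2"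
    and meets_y12: "twisted_meets q u1 u2 (y1 + y2) (y1 + y2)"
  obtains a1 c1 a2 c2 l
  where "a1 *s u1 + c1 *s u2 = y1" and "a1 ^ q *s u1 + c1 ^ q *s u2 = l *s y1"
    and "a2 *s u1 + c2 *s u2 = y2" and "a2 ^ q *s u1 + c2 ^ q *s u2 = l *s y2"
proof -
  obtain a1 c1 l1 where 1: "a1 *s u1 + c1 *s u2 = y1" "a1 ^ q *s u1 + c1 ^ q *s u2 = l1 *s y1"
    using twisted_meets_normalize[OF u meets_y1] .
  obtain a2 c2 l2 where 2: "a2 *s u1 + c2 *s u2 = y2" "a2 ^ q *s u1 + c2 ^ q *s u2 = l2 *s y2"
    using twisted_meets_normalize[OF u meets_y2] .
  obtain a3 c3 l3 where 3: "a3 *s u1 + c3 *s u2 = y1 + y2"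
    "a3 ^ q *s u1 + c3 ^ q *s u2 = l3 *s (y1 + y2)"
    using twisted_meets_normalize[OF u meets_y12] .
  have "(a3 - (a1 + a2)) *s u1 + (c3 - (c1 + c2)) *s u2
      = (a3 *s u1 + c3 *s u2) - (a1 *s u1 + c1 *s u2) - (a2 *s u1 + c2 *s u2)"
    by (simp add: vec_eq_iff algebra_simps)
  also have "\<dots> = 0"
    by (simp add: 1(1) 2(1) 3(1))
  finally have "a3 - (a1 + a2) = 0 \<and> c3 - (c1 + c2) = 0"
    using u unfolding lin_indep2_def by blast
  then have "l3 *s (y1 + y2) = (a1 ^ q *s u1 + c1 ^ q *s u2) + (a2 ^ q *s u1 + c2 ^ q *s u2)"
    unfolding 3(2)[symmetric] by (simp add: frobenius_add vec_eq_iff algebra_simps)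
  also have "\<dots> = l1 *s y1 + l2 *s y2"
    by (simp add: 1(2) 2(2))
  finally have "(l1 - l3) *s y1 + (l2 - l3) *s y2 = 0"
    by (simp add: vec_eq_iff algebra_simps)
  then have "l1 - l3 = 0 \<and> l2 - l3 = 0"
    using y unfolding lin_indep2_def by blast
  then show ?thesis
    using that 1 2 by simp
qed

lemma twisted_meets_frame:
  fixes u1 u2 y1 y2 :: "'a^'n"
  assumes inj: "\<And>a c. a *s u1 + c *s u2 = 0 \<Longrightarrow> a ^ q *s u1 + c ^ q *s u2 = 0 \<Longrightarrow> a = 0 \<and> c = 0"
    and y: "lin_indep2 y1 y2"
    and meets_y1: "twisted_meets q u1 u2 y1 y1" and meets_y2: "twisted_meets q u1 u2 y2 y2"
    and meets_y12: "twisted_meets q u1 u2 (y1 + y2) (y1 + y2)"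
    and \<xi>: "\<xi>1 \<noteq> 0 \<or> \<xi>2 \<noteq> 0"
  shows "twisted_meets q u1 u2 (\<xi>1 *s y1 + \<xi>2 *s y2) (\<xi>1 ^ q *s y1 + \<xi>2 ^ q *s y2)"
proof -
  have u: "lin_indep2 u1 u2"
    using lin_indep2_if_span2[OF y twisted_meets_in_span2[OF inj meets_y1]
        twisted_meets_in_span2[OF inj meets_y2]] .
  obtain a1 c1 a2 c2 l
    where 1: "a1 *s u1 + c1 *s u2 = y1" "a1 ^ q *s u1 + c1 ^ q *s u2 = l *s y1"
      and 2: "a2 *s u1 + c2 *s u2 = y2" "a2 ^ q *s u1 + c2 ^ q *s u2 = l *s y2"
    using twisted_meets_common_scalar[OF u y meets_y1 meets_y2 meets_y12] .
  define a c where "a = \<xi>1 * a1 + \<xi>2 * a2" and "c = \<xi>1 * c1 + \<xi>2 * c2"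
  have "a *s u1 + c *s u2 = \<xi>1 *s (a1 *s u1 + c1 *s u2) + \<xi>2 *s (a2 *s u1 + c2 *s u2)"
    by (simp add: a_def c_def vec_eq_iff algebra_simps)
  then have "a *s u1 + c *s u2 = 1 *s (\<xi>1 *s y1 + \<xi>2 *s y2)"
    by (simp add: 1(1) 2(1))
  moreover have "a ^ q *s u1 + c ^ q *s u2
      = \<xi>1 ^ q *s (a1 ^ q *s u1 + c1 ^ q *s u2) + \<xi>2 ^ q *s (a2 ^ q *s u1 + c2 ^ q *s u2)"
    by (simp add: a_def c_def frobenius_add power_mult_distrib vec_eq_iff algebra_simps)
  then have "a ^ q *s u1 + c ^ q *s u2 = l *s (\<xi>1 ^ q *s y1 + \<xi>2 ^ q *s y2)"
    by (simp add: 1(2) 2(2) vec_eq_iff algebra_simps)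
  moreover have "\<xi>1 *s y1 + \<xi>2 *s y2 \<noteq> 0"
    using y \<xi> unfolding lin_indep2_def by blast
  ultimately show ?thesis
    unfolding twisted_meets_def by (metis vector_smult_lid vector_smult_lzero add.right_neutral)
qed

end

locale skew_transversal = frobenius_involution field q
  for field :: "'a::field itself" and q +
  fixes B :: "'a^'n^'m"
  assumes nonsingular_B: "nonsingular B"
    and skew: "\<forall>x y. B *v x = vconj q (B *v y) \<longrightarrow> B *v x = 0"
begin

(* Coordinates D(s,t) on Sigma_inf^* = g + g^q, where g = range B. *)
definition transversal_sum :: "'a^'n \<Rightarrow> 'a^'n \<Rightarrow> 'a^'m" where
  "transversal_sum s t = B *v s + vconj q (B *v t)"

lemma transversal_sum_lincomb:
  "a *s transversal_sum s t + c *s transversal_sum s' t'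
    = transversal_sum (a *s s + c *s s') (a ^ q *s t + c ^ q *s t')"
  by (simp add: transversal_sum_def vec.add vec.scale vconj_add vconj_smult vector_add_ldistrib
      add_ac)

lemma smult_plus_vconj:
  "a *s (B *v s) + c *s vconj q (B *v t) = transversal_sum (a *s s) (c ^ q *s t)"
  by (simp add: transversal_sum_def vec.scale vconj_smult)

lemma vconj_transversal_sum: "vconj q (transversal_sum s t) = transversal_sum t s"
  by (simp add: transversal_sum_def vconj_add add.commute)

lemma transversal_sum_eq_0_iff [simp]: "transversal_sum s t = 0 \<longleftrightarrow> s = 0 \<and> t = 0"
proof
  assume "transversal_sum s t = 0"
  then have "B *v s = vconj q (B *v (- t))"
    by (simp add: transversal_sum_def vec.neg vconj_minus eq_neg_iff_add_eq_0)
  then have "B *v s = 0"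
    using skew by blast
  then have "s = 0"
    using nonsingular_B unfolding nonsingular_def by blast
  with \<open>transversal_sum s t = 0\<close> have "B *v t = 0"
    by (simp add: transversal_sum_def)
  then show "s = 0 \<and> t = 0"
    using \<open>s = 0\<close> nonsingular_B unfolding nonsingular_def by blast
qed (simp add: transversal_sum_def)

lemma transversal_sum_eq_iff:
  "transversal_sum s t = transversal_sum s' t' \<longleftrightarrow> s = s' \<and> t = t'"
proof -
  have "transversal_sum s t - transversal_sum s' t' = transversal_sum (s - s') (t - t')"
    by (simp add: transversal_sum_def vec.diff vconj_diff)
  then show ?thesis
    by (metis eq_iff_diff_eq_0 transversal_sum_eq_0_iff)
qed

lemma rational_transversal_sum_iff: "rational q (transversal_sum s t) \<longleftrightarrow> s = t"
  unfolding rational_def vconj_transversal_sum transversal_sum_eq_iff by blast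

lemma lin_indep2_transversal:
  assumes "s \<noteq> 0" "t \<noteq> 0"
  shows "lin_indep2 (B *v s) (vconj q (B *v t))"
  using assms unfolding lin_indep2_def smult_plus_vconj by simp

lemma meets_transversal_span2_iff:
  assumes indep: "lin_indep2 (transversal_sum u1 u1) (transversal_sum u2 u2)"
  shows "meets (span2 (transversal_sum u1 u1) (transversal_sum u2 u2)) (span2 (B *v s) (vconj q (B *v t)))
    \<longleftrightarrow> twisted_meets q u1 u2 s t"
proof
  assume "meets (span2 (transversal_sum u1 u1) (transversal_sum u2 u2)) (span2 (B *v s) (vconj q (B *v t)))"
  then obtain a c \<alpha> \<beta> where nz: "a *s transversal_sum u1 u1 + c *s transversal_sum u2 u2 \<noteq> 0"
    and eq: "a *s transversal_sum u1 u1 + c *s transversal_sum u2 u2 = \<alpha> *s (B *v s) + \<beta> *s vconj q (B *v t)"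
    unfolding meets_def in_span2_iff by blast
  from eq have "a *s u1 + c *s u2 = \<alpha> *s s \<and> a ^ q *s u1 + c ^ q *s u2 = \<beta> ^ q *s t"
    unfolding transversal_sum_lincomb smult_plus_vconj transversal_sum_eq_iff .
  moreover have "a \<noteq> 0 \<or> c \<noteq> 0"
    using nz by auto
  ultimately show "twisted_meets q u1 u2 s t"
    unfolding twisted_meets_def by blast
next
  assume "twisted_meets q u1 u2 s t"
  then obtain a c \<alpha> \<beta> where ac: "a \<noteq> 0 \<or> c \<noteq> 0"
    and st: "a *s u1 + c *s u2 = \<alpha> *s s" "a ^ q *s u1 + c ^ q *s u2 = \<beta> *s t"
    unfolding twisted_meets_def by blast
  have "a *s transversal_sum u1 u1 + c *s transversal_sum u2 u2
      = \<alpha> *s (B *v s) + \<beta> ^ q *s vconj q (B *v t)"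
    unfolding transversal_sum_lincomb smult_plus_vconj st by simp
  moreover have "a *s transversal_sum u1 u1 + c *s transversal_sum u2 u2 \<noteq> 0"
    using indep ac unfolding lin_indep2_def by blast
  ultimately show "meets (span2 (transversal_sum u1 u1) (transversal_sum u2 u2))
      (span2 (B *v s) (vconj q (B *v t)))"
    unfolding meets_def in_span2_iff by blast
qed

lemma lin_indep2_on_spread_lines:
  assumes y: "lin_indep2 y1 y2" and "\<alpha>1 \<noteq> 0 \<or> \<beta>1 \<noteq> 0" and "\<alpha>2 \<noteq> 0 \<or> \<beta>2 \<noteq> 0"
  shows "lin_indep2 (transversal_sum (\<alpha>1 *s y1) (\<beta>1 *s y1)) (transversal_sum (\<alpha>2 *s y2) (\<beta>2 *s y2))"
  unfolding lin_indep2_def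
proof (intro allI impI)
  fix e f
  assume "e *s transversal_sum (\<alpha>1 *s y1) (\<beta>1 *s y1) + f *s transversal_sum (\<alpha>2 *s y2) (\<beta>2 *s y2) = 0"
  then have "(e * \<alpha>1) *s y1 + (f * \<alpha>2) *s y2 = 0" "(e ^ q * \<beta>1) *s y1 + (f ^ q * \<beta>2) *s y2 = 0"
    unfolding transversal_sum_lincomb transversal_sum_eq_0_iff by (simp_all add: vector_smult_assoc)
  then have "e * \<alpha>1 = 0 \<and> f * \<alpha>2 = 0" "e ^ q * \<beta>1 = 0 \<and> f ^ q * \<beta>2 = 0"
    using y unfolding lin_indep2_def by blast+
  then show "e = 0 \<and> f = 0"
    using assms(2,3) by auto
qed

lemma rational_line_transversal_basis:
  assumes m: "is_rational_line q m" and y: "lin_indep2 y1 y2"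
    and meets_y: "\<And>y. y \<in> {y1, y2} \<Longrightarrow> meets m (span2 (B *v y) (vconj q (B *v y)))"
  obtains u1 u2 where "m = span2 (transversal_sum u1 u1) (transversal_sum u2 u2)"
    and "lin_indep2 (transversal_sum u1 u1) (transversal_sum u2 u2)"
proof -
  obtain w1 w2 where w: "rational q w1" "rational q w2" "lin_indep2 w1 w2" and m_eq: "m = span2 w1 w2"
    using m unfolding is_rational_line_def by blast
  have on_spread: "\<exists>\<alpha> \<beta>. (\<alpha> \<noteq> 0 \<or> \<beta> \<noteq> 0) \<and> transversal_sum (\<alpha> *s y) (\<beta> *s y) \<in> m"
    if y_in: "y \<in> {y1, y2}" for y
  proof -
    obtain \<alpha> \<beta> where "\<alpha> *s (B *v y) + \<beta> *s vconj q (B *v y) \<in> m"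
      "\<alpha> *s (B *v y) + \<beta> *s vconj q (B *v y) \<noteq> 0"
      using meets_y[OF y_in] unfolding meets_def in_span2_iff by blast
    then show ?thesis
      unfolding smult_plus_vconj by (intro exI[of _ \<alpha>] exI[of _ "\<beta> ^ q"]) auto
  qed
  obtain \<alpha>1 \<beta>1 \<alpha>2 \<beta>2 where 1: "\<alpha>1 \<noteq> 0 \<or> \<beta>1 \<noteq> 0" "transversal_sum (\<alpha>1 *s y1) (\<beta>1 *s y1) \<in> m"
    and 2: "\<alpha>2 \<noteq> 0 \<or> \<beta>2 \<noteq> 0" "transversal_sum (\<alpha>2 *s y2) (\<beta>2 *s y2) \<in> m"
    using on_spread[of y1] on_spread[of y2] by blast
  define z1 z2 where "z1 = transversal_sum (\<alpha>1 *s y1) (\<beta>1 *s y1)"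
    and "z2 = transversal_sum (\<alpha>2 *s y2) (\<beta>2 *s y2)"
  have z: "lin_indep2 z1 z2"
    unfolding z1_def z2_def using lin_indep2_on_spread_lines[OF y 1(1) 2(1)] .
  have "z1 \<in> span2 w1 w2" "z2 \<in> span2 w1 w2"
    using 1(2) 2(2) by (simp_all add: z1_def z2_def m_eq)
  then have "span2 w1 w2 \<subseteq> span2 z1 z2"
    by (rule span2_subset_if_lin_indep2[OF z])
  then have "w1 \<in> span2 z1 z2" "w2 \<in> span2 z1 z2"
    using span2_base by blast+
  moreover have "\<exists>u. w = transversal_sum u u"
    if w_span: "w \<in> span2 z1 z2" and w_rational: "rational q w" for w
  proof -
    obtain e f where "w = e *s z1 + f *s z2"
      using w_span unfolding in_span2_iff by blast
    then obtain s t where "w = transversal_sum s t"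
      unfolding z1_def z2_def transversal_sum_lincomb by blast
    then show ?thesis
      using w_rational by (auto simp: rational_transversal_sum_iff)
  qed
  ultimately obtain u1 u2 where "w1 = transversal_sum u1 u1" "w2 = transversal_sum u2 u2"
    using w by metis
  then show ?thesis
    using that w(3) m_eq by blast
qed

end

section \<open>The extended regulus\<close>

lemma ext_regulus_comp: "ext_regulus q (\<lambda>x. f (g x)) b = ext_regulus q f (g ` b)"
  unfolding ext_regulus_def opposite_regulus_def spread_line_def by simp

lemma frobenius_pair_line_in_ext_regulus:
  fixes B :: "'a::field^2^5" and y1 y2 :: "'a^2"
  assumes "skew_transversal q B"
    and y: "lin_indep2 y1 y2" and b: "y1 \<in> b" "y2 \<in> b" "y1 + y2 \<in> b"
    and \<xi>: "\<xi>1 \<noteq> 0 \<or> \<xi>2 \<noteq> 0"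
  shows "span2 (B *v (\<xi>1 *s y1 + \<xi>2 *s y2)) (vconj q (B *v (\<xi>1 ^ q *s y1 + \<xi>2 ^ q *s y2)))
    \<in> ext_regulus q ((*v) B) b"
proof -
  interpret skew_transversal "TYPE('a)" q B by fact
  let ?L = "span2 (B *v (\<xi>1 *s y1 + \<xi>2 *s y2)) (vconj q (B *v (\<xi>1 ^ q *s y1 + \<xi>2 ^ q *s y2)))"
  have "\<xi>1 *s y1 + \<xi>2 *s y2 \<noteq> 0" "\<xi>1 ^ q *s y1 + \<xi>2 ^ q *s y2 \<noteq> 0"
    using y \<xi> unfolding lin_indep2_def by (metis frobenius_eq_0_iff)+
  then have "is_line ?L"
    unfolding is_line_def using lin_indep2_transversal by blast
  moreover have "meets ?L m" if "m \<in> opposite_regulus q ((*v) B) b" for m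
  proof -
    have rational: "is_rational_line q m"
      and spread: "\<And>y. y \<in> b \<Longrightarrow> meets m (span2 (B *v y) (vconj q (B *v y)))"
      using that unfolding opposite_regulus_def spread_line_def by auto
    obtain u1 u2 where m: "m = span2 (transversal_sum u1 u1) (transversal_sum u2 u2)"
      and w: "lin_indep2 (transversal_sum u1 u1) (transversal_sum u2 u2)"
      using rational_line_transversal_basis[OF rational y] spread b by blast
    have inj: "a = 0 \<and> c = 0" if "a *s u1 + c *s u2 = 0" "a ^ q *s u1 + c ^ q *s u2 = 0" for a c
      using w that unfolding lin_indep2_def transversal_sum_lincomb by simp
    have "twisted_meets q u1 u2 y y" if "y \<in> b" for y
      using spread[OF that] meets_transversal_span2_iff[OF w] m by simp
    then have "twisted_meets q u1 u2 (\<xi>1 *s y1 + \<xi>2 *s y2) (\<xi>1 ^ q *s y1 + \<xi>2 ^ q *s y2)"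
      using twisted_meets_frame[OF inj y _ _ _ \<xi>] b by blast
    then have "meets m ?L"
      using meets_transversal_span2_iff[OF w] m by simp
    then show ?thesis
      using meets_commute by blast
  qed
  ultimately show ?thesis
    unfolding ext_regulus_def by blast
qed

lemma conjugate_pair_line_in_ext_regulus:
  fixes B :: "'a::field^2^5" and m1 m2 :: "'a^2"
  assumes "skew_transversal q B" and \<theta>: "field_aut \<theta>"
    and frame: "baer_frame q b m1 m2"
    and x: "x1 \<noteq> 0 \<or> x2 \<noteq> 0" and \<kappa>: "\<kappa> \<noteq> 0"
  shows "span2 (semilin B \<theta> (x1 *s m1 + x2 *s m2))
      (vconj q (semilin B \<theta> (\<kappa> *s (x1 ^ q *s m1 + x2 ^ q *s m2))))
    \<in> ext_regulus q (semilin B \<theta>) b"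
proof -
  interpret skew_transversal "TYPE('a)" q B by fact
  define y1 y2 where "y1 = vmap \<theta> m1" and "y2 = vmap \<theta> m2"
  have vmap: "vmap \<theta> (a *s m1 + c *s m2) = \<theta> a *s y1 + \<theta> c *s y2" for a c
    unfolding y1_def y2_def by (rule vmap_lincomb[OF \<theta>])
  have indep: "lin_indep2 y1 y2"
    using lin_indep2_vmap[OF \<theta>] frame unfolding y1_def y2_def baer_frame_def by blast
  have "y1 + y2 = vmap \<theta> (m1 + m2)"
    using vmap[of 1 1] by (simp add: field_aut_1[OF \<theta>])
  then have points: "y1 \<in> vmap \<theta> ` b" "y2 \<in> vmap \<theta> ` b" "y1 + y2 \<in> vmap \<theta> ` b"
    using baer_frame_points[OF frame] unfolding y1_def y2_def by simp_all
  have "\<theta> x1 \<noteq> 0 \<or> \<theta> x2 \<noteq> 0"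
    using x by (simp add: field_aut_eq_0_iff[OF \<theta>])
  note line = frobenius_pair_line_in_ext_regulus[OF \<open>skew_transversal q B\<close> indep points this]
  have "semilin B \<theta> (\<kappa> *s (x1 ^ q *s m1 + x2 ^ q *s m2))
      = B *v vmap \<theta> ((\<kappa> * x1 ^ q) *s m1 + (\<kappa> * x2 ^ q) *s m2)"
    by (simp add: semilin_eq_vmap vector_add_ldistrib vector_smult_assoc)
  also have "\<dots> = B *v (\<theta> \<kappa> *s (\<theta> x1 ^ q *s y1 + \<theta> x2 ^ q *s y2))"
    by (simp add: vmap field_aut_mult[OF \<theta>] field_aut_power[OF \<theta>] vector_add_ldistrib
        vector_smult_assoc)
  finally have Q_image: "semilin B \<theta> (\<kappa> *s (x1 ^ q *s m1 + x2 ^ q *s m2))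
      = \<theta> \<kappa> *s (B *v (\<theta> x1 ^ q *s y1 + \<theta> x2 ^ q *s y2))"
    by (simp add: vec.scale)
  have "\<theta> \<kappa> ^ q \<noteq> 0"
    using \<kappa> by (simp add: field_aut_eq_0_iff[OF \<theta>])
  moreover have "semilin B \<theta> (x1 *s m1 + x2 *s m2) = B *v (\<theta> x1 *s y1 + \<theta> x2 *s y2)"
    by (simp add: semilin_eq_vmap vmap)
  moreover have "ext_regulus q (semilin B \<theta>) b = ext_regulus q ((*v) B) (vmap \<theta> ` b)"
    using ext_regulus_comp[of q "(*v) B" "vmap \<theta>" b] by (simp add: semilin_eq_vmap[abs_def])
  ultimately show ?thesis
    using line by (simp add: Q_image vconj_smult span2_smult_right)
qed

theorem theorem3p2:
  fixes q :: nat
    and h :: "'a::{finite,field} ^5"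
    and B :: "'a ^2 ^5"
    and \<theta> :: "'a \<Rightarrow> 'a"
    and b :: "('a ^2) set"
    and P Q :: "'a ^2"
  assumes q_pp: "\<exists>p k. prime p \<and> k > 0 \<and> q = p ^ k"
    and card: "CARD('a) = q ^ 2"
    \<comment> \<open>Sigma_inf: the hyperplane of PG(4,q) with rational equation h\<close>
    and h_rat: "rational q h" and h_nz: "h \<noteq> 0"
    \<comment> \<open>the transversal g = image of B, a line of Sigma_inf* disjoint from g^q;
        Tbar |-> T is the bijection x \<mapsto> B x^theta from l_inf onto g\<close>
    and B_nonsing: "nonsingular B"
    and g_in_Sigma: "\<forall>x. (\<Sum>i\<in>UNIV. h $ i * (B *v x) $ i) = 0"
    and g_skew: "\<forall>x y. B *v x = vconj q (B *v y) \<longrightarrow> B *v x = 0"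
    and aut: "field_aut \<theta>"
    \<comment> \<open>b a Baer subline of l_inf, P,Q distinct points of l_inf, conjugate w.r.t. b\<close>
    and b: "baer_subline q b"
    and P_nz: "P \<noteq> 0" and Q_nz: "Q \<noteq> 0" and PQ: "\<not> same_point P Q"
    and conj: "conjugate_wrt b P Q"
  shows "span2 (semilin B \<theta> P) (vconj q (semilin B \<theta> Q)) \<in> ext_regulus q (semilin B \<theta>) b
       \<and> span2 (vconj q (semilin B \<theta> P)) (semilin B \<theta> Q) \<in> ext_regulus q (semilin B \<theta>) b"
proof -
  have transversal: "skew_transversal q B"
    using frobenius_involution_if_card_square[OF q_pp card] B_nonsing g_skew
    by (intro skew_transversal.intro skew_transversal_axioms.intro)
  interpret skew_transversal "TYPE('a)" q B
    by (fact transversal)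
  obtain m1 m2 where frame: "baer_frame q b m1 m2"
    using baer_subline_has_frame[OF b] by blast
  note line = conjugate_pair_line_in_ext_regulus[OF transversal aut frame]
  have "span2 (semilin B \<theta> X) (vconj q (semilin B \<theta> Y)) \<in> ext_regulus q (semilin B \<theta>) b"
    if "conjugate_wrt b X Y" "\<not> same_point X Y" for X Y
    using conjugate_wrt_frame_coordinates[OF frame that] line by metis
  from this[OF conj PQ] this[of Q P] show ?thesis
    using conj PQ by (simp add: conjugate_wrt_commute same_point_commute span2_commute)
qed

end
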